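(* Let $F$ be a field, let $b_m,b_{m-1},\ldots,b_0\in F$ with $b_m\ne0$, and put $b_j=0$ for $j<0$. For a positive integer $k$ let $\Delta_k$ be the determinant of order $k$ $$\Delta_k=\left|\begin{array}{lllll} -b_{m-1}&b_m&0&\dots&0\\ -b_{m-2}&-b_{m-1}&b_m&\ddots&\vdots\\ \vdots&\vdots&\ddots&\ddots&0\\ -b_{m-k+1}&-b_{m-k+2}&&\ddots&b_m\\ -b_{m-k}&-b_{m-k+1}&-b_{m-k+2}&\dots&-b_{m-1} \end{array}\right| .$$ Then $$\Delta_k=(-1)^kb_m^k\sum_{i=1}^{k}t_i\,b_{m-(k+1)+i}=(-1)^kb_m^k\sum_{j=0}^{k-1}t_{k-j}\,b_{(m-1)-j},$$ where $\{t_r\}$ is the linear recurrent sequence given by $t_1=\frac1{b_m}$ and $t_r=\frac1{b_m}\sum_{i=1}^{r-1}b_{m-i}t_{r-i}$ for $r=2,3,\ldots$.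
   Context: Explicitly, the matrix whose determinant is $\Delta_k$ is the $k\times k$ lower Hessenberg-Toeplitz matrix whose $(r,c)$ entry is $-b_{m-1-(r-c)}$ if $c\le r$, is $b_m$ if $c=r+1$, and is $0$ if $c>r+1$. Convention: $b_j=0$ for negative $j$. *)

theory Defs
  imports "Jordan_Normal_Form.Determinant"
begin

(* Coefficients are indexed by integers so that b_j = 0 for j < 0 can be imposed literally.
   JNF matrices are indexed from 0; since the entries depend only on r - c, the formulas are
   those of the matrix with rows and columns numbered 1..k. *)
definition hess_toeplitz :: "(int \<Rightarrow> 'a :: field) \<Rightarrow> nat \<Rightarrow> nat \<Rightarrow> 'a mat" where
  "hess_toeplitz b m k = mat k k (\<lambda>(r, c).
     if c \<le> r then - b (int m - 1 - (int r - int c))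
     else if c = r + 1 then b (int m)
     else 0)"

definition Delta :: "(int \<Rightarrow> 'a :: field) \<Rightarrow> nat \<Rightarrow> nat \<Rightarrow> 'a" where
  "Delta b m k = det (hess_toeplitz b m k)"

end

theory Submission
  imports Defs
begin

text \<open>
  Write \<open>S k\<close> for the convolution sum on the right. The recurrence says that \<open>S k\<close> equals
  \<open>b m * t (k + 1)\<close>, and this is exactly what is needed to make the vector
  \<open>(t 1, \<dots>, t k)\<close> almost lie in the kernel of the Hessenberg matrix: in every row \<open>r\<close> but
  the last, counting from 0, the superdiagonal entry \<open>b m\<close> contributes \<open>b m * t (r + 2)\<close> and cancels the rest of the row,
  while the last row, which has no superdiagonal entry, gives \<open>- S k\<close>. By Cramer's rule, read off
  in the first unknown, the determinant times \<open>t 1\<close> is the determinant of the matrix whose first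
  column has been replaced by \<open>(0, \<dots>, 0, - S k)\<close>. Deleting the first column and the last row
  moves the superdiagonal onto the diagonal, so the remaining minor is triangular and equals
  \<open>b m ^ (k - 1)\<close>. Since \<open>t 1\<close> is the inverse of \<open>b m\<close>, this is the claim.
\<close>

text \<open>
  Up to sign, the left-hand side is row \<open>r\<close> of the Hessenberg matrix, cut off at the diagonal,
  applied to \<open>(t 1, t 2, \<dots>)\<close>; reversing the order of summation turns it into one step of the
  recurrence.
\<close>

lemma recurrence_as_convolution:
  fixes b :: "int \<Rightarrow> 'a :: field" and t :: "nat \<Rightarrow> 'a"
  assumes bm: "b (int m) \<noteq> 0"
    and rec: "\<And>r. r \<ge> 2 \<Longrightarrow> t r = 1 / b (int m) * (\<Sum>i=1..r-1. b (int m - int i) * t (r - i))"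
  shows "(\<Sum>c\<le>r. b (int m - 1 - (int r - int c)) * t (Suc c)) = b (int m) * t (r + 2)"
proof -
  have "(\<Sum>c\<le>r. b (int m - 1 - (int r - int c)) * t (Suc c))
      = (\<Sum>i=1..r+1. b (int m - int i) * t (r + 2 - i))"
    by (rule sum.reindex_bij_witness[where i = "\<lambda>i. r + 1 - i" and j = "\<lambda>c. r + 1 - c"])
       (auto simp: of_nat_diff Suc_diff_le algebra_simps)
  also have "\<dots> = b (int m) * t (r + 2)"
    using rec[of "r + 2"] bm by simp
  finally show ?thesis .
qed

lemma hess_toeplitz_carrier: "hess_toeplitz b m k \<in> carrier_mat k k"
  by (simp add: hess_toeplitz_def)

lemma hess_toeplitz_mult_solution:
  fixes b :: "int \<Rightarrow> 'a :: field" and t :: "nat \<Rightarrow> 'a"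
  assumes bm: "b (int m) \<noteq> 0"
    and rec: "\<And>r. r \<ge> 2 \<Longrightarrow> t r = 1 / b (int m) * (\<Sum>i=1..r-1. b (int m - int i) * t (r - i))"
  shows "hess_toeplitz b m (Suc n) *\<^sub>v vec (Suc n) (\<lambda>i. t (Suc i))
       = vec (Suc n) (\<lambda>r. if r = n then - (b (int m) * t (n + 2)) else 0)"
    (is "?A *\<^sub>v ?x = _")
proof (rule eq_vecI)
  fix r assume "r < dim_vec (vec (Suc n) (\<lambda>r. if r = n then - (b (int m) * t (n + 2)) else 0))"
  then have r: "r < Suc n" by simp
  let ?f = "\<lambda>c. ?A $$ (r, c) * t (Suc c)"
  have low: "(\<Sum>c\<le>r. ?f c) = - (b (int m) * t (r + 2))"
  proof -
    have "(\<Sum>c\<le>r. ?f c) = (\<Sum>c\<le>r. - (b (int m - 1 - (int r - int c)) * t (Suc c)))"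
      using r by (intro sum.cong) (auto simp: hess_toeplitz_def)
    then show ?thesis
      using recurrence_as_convolution[OF bm rec] by (simp add: sum_negf)
  qed
  have "(?A *\<^sub>v ?x) $ r = (\<Sum>c<Suc n. ?f c)"
    using r by (simp add: hess_toeplitz_def scalar_prod_def atLeast0LessThan)
  also have "\<dots> = (if r = n then - (b (int m) * t (n + 2)) else 0)"
  proof (cases "r = n")
    case True
    then show ?thesis using low by (simp add: lessThan_Suc_atMost)
  next
    case False
    \<comment> \<open>Columns beyond the superdiagonal vanish, so the row ends at column \<open>r + 1\<close>.\<close>
    have "(\<Sum>c<Suc n. ?f c) = (\<Sum>c\<le>Suc r. ?f c)"
      using r False by (intro sum.mono_neutral_right) (auto simp: hess_toeplitz_def)
    also have "\<dots> = 0"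
      using low r False by (simp add: hess_toeplitz_def)
    finally show ?thesis using False by simp
  qed
  finally show "(?A *\<^sub>v ?x) $ r
      = vec (Suc n) (\<lambda>r. if r = n then - (b (int m) * t (n + 2)) else 0) $ r"
    using r by simp
qed (simp add: hess_toeplitz_def)

text \<open>
  Deleting the last row and the first column shifts the superdiagonal onto the diagonal and
  leaves a lower triangular matrix, so only one cofactor survives and it is a power of \<open>b m\<close>.
\<close>

lemma det_hess_toeplitz_replace_first_col:
  fixes b :: "int \<Rightarrow> 'a :: field"
  shows "det (replace_col (hess_toeplitz b m (Suc n)) (vec (Suc n) (\<lambda>r. if r = n then s else 0)) 0)
       = (-1) ^ n * s * b (int m) ^ n"
    (is "det ?C = _")
proof -
  have C: "?C \<in> carrier_mat (Suc n) (Suc n)"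
    by (simp add: replace_col_def hess_toeplitz_def)
  let ?D = "mat_delete ?C n 0"
  have D: "?D \<in> carrier_mat n n"
    using C by (auto simp: mat_delete_def)
  have "det ?D = prod_list (diag_mat ?D)"
    by (rule det_lower_triangular[OF _ D])
       (auto simp: mat_delete_def replace_col_def hess_toeplitz_def)
  also have "diag_mat ?D = replicate n (b (int m))"
    by (rule nth_equalityI)
       (auto simp: diag_mat_def mat_delete_def replace_col_def hess_toeplitz_def)
  finally have D_det: "det ?D = b (int m) ^ n" by simp
  have "det ?C = (\<Sum>i<Suc n. ?C $$ (i, 0) * cofactor ?C i 0)"
    by (rule laplace_expansion_column[OF C]) simp
  also have "\<dots> = s * cofactor ?C n 0"
    by (simp add: replace_col_def hess_toeplitz_def)
  finally show ?thesis
    by (simp add: cofactor_def D_det)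
qed

text \<open>
  The closed form in terms of a single member of the recurrent sequence; the convolution sums of
  the theorem are \<open>b m * t (k + 1)\<close> unfolded once.
\<close>

lemma Delta_eq_recurrent_sequence:
  fixes b :: "int \<Rightarrow> 'a :: field" and t :: "nat \<Rightarrow> 'a"
  assumes bm: "b (int m) \<noteq> 0"
    and t1: "t 1 = 1 / b (int m)"
    and rec: "\<And>r. r \<ge> 2 \<Longrightarrow> t r = 1 / b (int m) * (\<Sum>i=1..r-1. b (int m - int i) * t (r - i))"
  shows "Delta b m (Suc n) = (-1) ^ Suc n * b (int m) ^ Suc n * (b (int m) * t (n + 2))"
proof -
  let ?A = "hess_toeplitz b m (Suc n)" and ?x = "vec (Suc n) (\<lambda>i. t (Suc i))"
  have "det (replace_col ?A (?A *\<^sub>v ?x) 0) = ?x $ 0 * det ?A"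
    by (rule cramer_lemma_mat[OF hess_toeplitz_carrier]) auto
  moreover have "?A *\<^sub>v ?x = vec (Suc n) (\<lambda>r. if r = n then - (b (int m) * t (n + 2)) else 0)"
    by (rule hess_toeplitz_mult_solution[OF bm rec])
  ultimately have "t 1 * Delta b m (Suc n)
      = (-1) ^ n * - (b (int m) * t (n + 2)) * b (int m) ^ n"
    by (simp only: det_hess_toeplitz_replace_first_col) (simp add: Delta_def)
  then show ?thesis
    using bm unfolding t1 by (simp add: field_simps)
qed

theorem theorem5p1:
  fixes b :: "int \<Rightarrow> 'a :: field" and t :: "nat \<Rightarrow> 'a" and m k :: nat
  assumes "b (int m) \<noteq> 0"
    and "\<And>j. j < 0 \<Longrightarrow> b j = 0"
    and "k \<ge> 1"
    and "t 1 = 1 / b (int m)"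
    and "\<And>r. r \<ge> 2 \<Longrightarrow> t r = 1 / b (int m) * (\<Sum>i=1..r-1. b (int m - int i) * t (r - i))"
  shows "Delta b m k = (-1) ^ k * b (int m) ^ k * (\<Sum>i=1..k. t i * b (int m - (int k + 1) + int i))
       \<and> Delta b m k = (-1) ^ k * b (int m) ^ k * (\<Sum>j=0..k-1. t (k - j) * b ((int m - 1) - int j))"
proof -
  obtain n where k: "k = Suc n"
    using assms(3) by (cases k) auto
  let ?S = "\<Sum>c\<le>n. b (int m - 1 - (int n - int c)) * t (Suc c)"
  have "?S = b (int m) * t (n + 2)"
    by (rule recurrence_as_convolution[OF assms(1,5)])
  moreover have "Delta b m (Suc n) = (-1) ^ Suc n * b (int m) ^ Suc n * (b (int m) * t (n + 2))"
    by (rule Delta_eq_recurrent_sequence[OF assms(1,4,5)])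
  ultimately have Delta: "Delta b m k = (-1) ^ k * b (int m) ^ k * ?S"
    by (simp only: k)
  have "?S = (\<Sum>i=1..k. t i * b (int m - (int k + 1) + int i))"
    unfolding k
    by (rule sum.reindex_bij_witness[where i = "\<lambda>i. i - 1" and j = Suc])
       (auto simp: of_nat_diff algebra_simps)
  moreover have "?S = (\<Sum>j=0..k-1. t (k - j) * b ((int m - 1) - int j))"
    unfolding k
    by (rule sum.reindex_bij_witness[where i = "\<lambda>j. n - j" and j = "\<lambda>c. n - c"])
       (auto simp: of_nat_diff Suc_diff_le algebra_simps)
  ultimately show ?thesis
    using Delta by simp
qed

end
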